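(* Let $G$ be a threshold graph on $\{0,1,\dots,n\}$ labeled by reverse degree sequence, with edges directed from $i$ to $j$ when $i>j$, degree sequence $(d_0,\dots,d_n)$, and let $\mathbf a=(a_1,\dots,a_n)\in\mathbb Z_{>0}^n$. Then \[\operatorname{Ehr}_{q,0}(\mathcal F_G(\mathbf a))=\prod_{i=1}^n q^{\bar d_i(a_i-1)}[\bar d_i]_q,\] where $\bar d_i=\min\{d_i,i\}$.
   Context: A threshold graph is built from one vertex by repeatedly adding a dominating vertex or an isolated vertex; labeled by reverse degree sequence means $d_i\ge d_j$ for $i<j$; $\bar d_i$ is the number of neighbors $j<i$ of $i$. $\mathcal F_G(\mathbf a)$ is the set of $x\in\mathbb R_{\ge0}^E$ such that for each vertex $k\ge1$ the flow out of $k$ (on edges to smaller vertices) minus the flow into $k$ equals $a_k$, and the net flow at $0$ is $-\sum a_i$. $wt_{q,t}(b)=\frac{q^b-t^b}{q-t}$ for $b>0$, $wt_{q,t}(0)=1$; for an integer flow $A=(a_{ij})$, $wt_{q,t}(A)=(-(1-t)(1-q))^{\#\{a_{ij}>0\}-n}\prod wt_{q,t}(a_{ij})$; $\operatorname{Ehr}_{q,t}(\mathcal F_G(\mathbf a))=\sum_{A\in\mathcal F_G(\mathbf a)\cap\mathbb Z^E}wt_{q,t}(A)$. $[k]_q=1+q+\dots+q^{k-1}$ (so $[0]_q=0$). *)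

theory Defs
  imports Complex_Main "HOL-Library.FuncSet"
begin

text \<open>A simple graph is given by its vertex set \<open>V\<close> and its set \<open>E\<close> of two-element edges.\<close>

inductive threshold_graph :: "'v set \<Rightarrow> 'v set set \<Rightarrow> bool" where
  single: "threshold_graph {v} {}"
| isolated: "threshold_graph V E \<Longrightarrow> v \<notin> V \<Longrightarrow> threshold_graph (insert v V) E"
| dominating: "threshold_graph V E \<Longrightarrow> v \<notin> V \<Longrightarrow>
    threshold_graph (insert v V) (E \<union> {{u, v} |u. u \<in> V})"

definition degree :: "'v set set \<Rightarrow> 'v \<Rightarrow> nat" where
  "degree E v = card {e \<in> E. v \<in> e}"

definition reverse_degree_labeled :: "nat \<Rightarrow> nat set set \<Rightarrow> bool" where
  "reverse_degree_labeled n E \<longleftrightarrow>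
    (\<forall>i\<in>{0..n}. \<forall>j\<in>{0..n}. i < j \<longrightarrow> degree E i \<ge> degree E j)"

definition dbar :: "nat set set \<Rightarrow> nat \<Rightarrow> nat" where
  "dbar E i = card {j. j < i \<and> {i, j} \<in> E}"

definition arcs :: "nat set set \<Rightarrow> (nat \<times> nat) set" where
  "arcs E = {(i, j). i > j \<and> {i, j} \<in> E}"

definition net_flow :: "nat set set \<Rightarrow> (nat \<times> nat \<Rightarrow> real) \<Rightarrow> nat \<Rightarrow> real" where
  "net_flow E x k =
    (\<Sum>e\<in>{e \<in> arcs E. fst e = k}. x e) - (\<Sum>e\<in>{e \<in> arcs E. snd e = k}. x e)"

text \<open>A vector indexed by the edges is an extensional function on \<open>arcs E\<close>, so that distinct
  functions are distinct points. Only the values \<open>a 1, \<dots>, a n\<close> of \<open>a\<close> matter.\<close>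

definition flow_polytope :: "nat \<Rightarrow> nat set set \<Rightarrow> (nat \<Rightarrow> int) \<Rightarrow> (nat \<times> nat \<Rightarrow> real) set" where
  "flow_polytope n E a =
    {x \<in> arcs E \<rightarrow>\<^sub>E {0..}.
      (\<forall>k\<in>{1..n}. net_flow E x k = of_int (a k)) \<and>
      net_flow E x 0 = - of_int (\<Sum>i=1..n. a i)}"

definition wt :: "'a::field \<Rightarrow> 'a \<Rightarrow> nat \<Rightarrow> 'a" where
  "wt q t b = (if b = 0 then 1 else (q ^ b - t ^ b) / (q - t))"

text \<open>On integer flows, the only ones this is applied to, \<open>nat \<lfloor>A e\<rfloor>\<close> is just the value \<open>A e\<close>.
  The exponent is an integer because it may be negative for a general netflow vector.\<close>

definition wt_flow ::
  "'a::field \<Rightarrow> 'a \<Rightarrow> nat \<Rightarrow> nat set set \<Rightarrow> (nat \<times> nat \<Rightarrow> real) \<Rightarrow> 'a" where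
  "wt_flow q t n E A =
    (- ((1 - t) * (1 - q))) powi (int (card {e \<in> arcs E. A e > 0}) - int n) *
    (\<Prod>e\<in>arcs E. wt q t (nat \<lfloor>A e\<rfloor>))"

definition Ehr :: "'a::field \<Rightarrow> 'a \<Rightarrow> nat \<Rightarrow> nat set set \<Rightarrow> (nat \<Rightarrow> int) \<Rightarrow> 'a" where
  "Ehr q t n E a =
    (\<Sum>A\<in>flow_polytope n E a \<inter> {x. \<forall>e\<in>arcs E. x e \<in> \<int>}. wt_flow q t n E A)"

definition q_int :: "'a::field \<Rightarrow> nat \<Rightarrow> 'a" where
  "q_int q k = (\<Sum>i<k. q ^ i)"

end

theory Submission
  imports Defs
begin

text \<open>
  At \<open>t = 0\<close> an edge carrying \<open>b > 0\<close> units has weight \<open>q ^ (b - 1)\<close>. In a threshold graph labeled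
  by reverse degree sequence, vertex \<open>i\<close> sends flow exactly to \<open>0, \<dots>, dbar i - 1\<close>, and every
  \<open>j < dbar i\<close> satisfies \<open>dbar j = j\<close>. Removing the last vertex \<open>n\<close> adds its outflow \<open>x j\<close> to
  \<open>a j\<close>, which by induction multiplies the result for the smaller graph by \<open>q ^ (j * x j)\<close>.
  The sum over the compositions \<open>x\<close> of \<open>a n\<close> into \<open>dbar n\<close> parts, weighted in this way, has a
  telescoping generating function and equals the factor belonging to \<open>n\<close>.
\<close>

section \<open>Weighted compositions\<close>

text \<open>Entries from \<open>m\<close> on are 0, so each composition is a single function, a new
  last part is a function update, and \<open>x\<close> can be added to a netflow vector as it
  stands.\<close>

definition weak_comps :: "nat \<Rightarrow> nat \<Rightarrow> (nat \<Rightarrow> nat) set" where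
  "weak_comps m b = {x. (\<forall>j. x j \<noteq> 0 \<longrightarrow> j < m) \<and> (\<Sum>j<m. x j) = b}"

text \<open>Splitting the factor \<open>(q - 1) ^ (\<dots> - n)\<close> of the flow weight into one exponent \<open>\<dots> - 1\<close> per
  vertex avoids division, so \<open>q = 1\<close> needs no special treatment. The truncated subtraction is
  harmless because every row that occurs has a positive entry.\<close>

definition row_wt :: "'a::field \<Rightarrow> nat \<Rightarrow> (nat \<Rightarrow> nat) \<Rightarrow> 'a" where
  "row_wt q m x = (q - 1) ^ (card {j. j < m \<and> 0 < x j} - 1) *
    (\<Prod>j<m. if x j = 0 then 1 else q ^ (x j - 1))"

lemma weak_comps_zero: "weak_comps m 0 = {\<lambda>_. 0}"
  by (auto simp: weak_comps_def fun_eq_iff)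

lemma card_support_pos:
  assumes "x \<in> weak_comps m b" "b > 0"
  shows "card {j. j < m \<and> 0 < x j} > 0"
proof -
  have "\<exists>j<m. 0 < x j"
  proof (rule ccontr)
    assume "\<not> ?thesis"
    then have "(\<Sum>j<m. x j) = 0" by simp
    then show False using assms by (simp add: weak_comps_def)
  qed
  then show ?thesis by (subst card_gt_0_iff) auto
qed

text \<open>Splits off the last part \<open>y\<close>; the recursion over the number of parts rests
  on it.\<close>

lemma bij_betw_weak_comps_Suc:
  "bij_betw (\<lambda>(y, x). x(m := y)) (SIGMA y:{..b}. weak_comps m (b - y)) (weak_comps (Suc m) b)"
proof (rule bij_betw_byWitness[where f' = "\<lambda>x. (x m, x(m := 0))"])
  have *: "(\<Sum>j<m. (x(m := y)) j) = (\<Sum>j<m. x j)" for x :: "nat \<Rightarrow> nat" and y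
    by (rule sum.cong) auto
  show "\<forall>p\<in>SIGMA y:{..b}. weak_comps m (b - y).
      (\<lambda>x. (x m, x(m := 0))) ((\<lambda>(y, x). x(m := y)) p) = p"
    by (auto simp: weak_comps_def fun_eq_iff)
  show "\<forall>x\<in>weak_comps (Suc m) b. (\<lambda>(y, x). x(m := y)) (x m, x(m := 0)) = x"
    by auto
  show "(\<lambda>(y, x). x(m := y)) ` (SIGMA y:{..b}. weak_comps m (b - y)) \<subseteq> weak_comps (Suc m) b"
    using * by (auto simp: weak_comps_def less_Suc_eq)
  show "(\<lambda>x. (x m, x(m := 0))) ` weak_comps (Suc m) b \<subseteq> (SIGMA y:{..b}. weak_comps m (b - y))"
    using * by (auto simp: weak_comps_def less_Suc_eq split: if_splits) blast
qed

lemma finite_weak_comps: "finite (weak_comps m b)"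
proof (induction m arbitrary: b)
  case 0
  show ?case by (rule finite_subset[of _ "{\<lambda>_. 0}"]) (auto simp: weak_comps_def)
next
  case (Suc m)
  show ?case
    using bij_betw_finite[OF bij_betw_weak_comps_Suc[of m b]] Suc by auto
qed

text \<open>The truncated subtraction stays outside the updated count, because a first positive
  entry leaves the exponent of \<open>q - 1\<close> at 0 while any further one raises it by
  1.\<close>

lemma row_wt_update:
  "row_wt q (Suc m) (x(m := y)) =
    (q - 1) ^ (card {j. j < m \<and> 0 < x j} + (if y = 0 then 0 else 1) - 1) *
    ((\<Prod>j<m. if x j = 0 then 1 else q ^ (x j - 1)) * (if y = 0 then 1 else q ^ (y - 1)))"
proof -
  have "{j. j < Suc m \<and> 0 < (x(m := y)) j} =
      {j. j < m \<and> 0 < x j} \<union> (if y = 0 then {} else {m})"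
    by (auto simp: less_Suc_eq)
  then have "card {j. j < Suc m \<and> 0 < (x(m := y)) j} =
      card {j. j < m \<and> 0 < x j} + (if y = 0 then 0 else 1)"
    by (simp add: card_insert_if)
  moreover have "(\<Prod>j<m. if (x(m := y)) j = 0 then 1 else q ^ ((x(m := y)) j - 1)) =
      (\<Prod>j<m. if x j = 0 then 1 else q ^ (x j - 1))"
    by (rule prod.cong) auto
  ultimately show ?thesis
    unfolding row_wt_def by simp
qed

text \<open>Multiplied by \<open>q - 1\<close>, this says that the generating function
  \<open>\<Prod>j<m. (1 - q ^ j * z) / (1 - q ^ (j + 1) * z)\<close> telescopes to \<open>(1 - z) / (1 - q ^ m * z)\<close>.\<close>

lemma sum_row_wt:
  fixes q :: "'a::field"
  assumes "b > 0"
  shows "(\<Sum>x\<in>weak_comps m b. row_wt q m x * q ^ (\<Sum>j<m. j * x j)) = q ^ (m * (b - 1)) * q_int q m"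
  using assms
proof (induction m arbitrary: b)
  case 0
  then show ?case by (simp add: weak_comps_def q_int_def)
next
  case (Suc m)
  define G where "G m x = row_wt q m x * q ^ (\<Sum>j<m. j * x j)" for m x
  have G_update: "G (Suc m) (x(m := y)) =
      row_wt q (Suc m) (x(m := y)) * q ^ (\<Sum>j<m. j * x j) * q ^ (m * y)" for x y
  proof -
    have "(\<Sum>j<m. j * (x(m := y)) j) = (\<Sum>j<m. j * x j)"
      by (rule sum.cong) auto
    then show ?thesis by (simp add: G_def power_add)
  qed
  \<comment> \<open>\<open>T y\<close> collects the compositions with last part \<open>y\<close>.
    For \<open>y = 0\<close> the row weight is unchanged; for \<open>y = b\<close> the last part is
    the only positive one; in between other parts are positive too, so exactly one factor
    \<open>q - 1\<close> is gained.\<close>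
  define T where "T y = (\<Sum>x\<in>weak_comps m (b - y). G (Suc m) (x(m := y)))" for y
  have T_0: "T 0 = q ^ (m * (b - 1)) * q_int q m"
    unfolding T_def using Suc.IH[OF Suc.prems]
    by (simp only: G_update row_wt_update) (simp add: row_wt_def)
  have T_b: "T b = q ^ (b - 1) * q ^ (m * b)"
    unfolding T_def G_update row_wt_update using Suc.prems by (simp add: weak_comps_zero)
  have T_mid: "T y = q ^ (m * (b - 1)) * q_int q m * ((q - 1) * q ^ (y - 1))"
    if y: "y \<in> {1..<b}" for y
  proof -
    have "G (Suc m) (x(m := y)) = G m x * ((q - 1) * q ^ (y - 1) * q ^ (m * y))"
      if "x \<in> weak_comps m (b - y)" for x
    proof -
      have "card {j. j < m \<and> 0 < x j} > 0"
        using card_support_pos[OF that] y by simp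
      then obtain c where "card {j. j < m \<and> 0 < x j} = Suc c"
        using gr0_implies_Suc by blast
      then show ?thesis
        using y by (simp only: G_update row_wt_update) (simp add: G_def row_wt_def)
    qed
    then have "T y = (\<Sum>x\<in>weak_comps m (b - y). G m x) * ((q - 1) * q ^ (y - 1) * q ^ (m * y))"
      unfolding T_def by (simp add: sum_distrib_right)
    also have "\<dots> = q ^ (m * (b - y - 1)) * q_int q m * ((q - 1) * q ^ (y - 1) * q ^ (m * y))"
      using Suc.IH[of "b - y"] y by (simp add: G_def)
    also have "\<dots> = q ^ (m * (b - y - 1) + m * y) * q_int q m * ((q - 1) * q ^ (y - 1))"
      by (simp add: power_add mult_ac)
    \<comment> \<open>The factor \<open>q ^ (m * y)\<close> makes up for the smaller total
      \<open>b - y\<close>, so that only a geometric sum over \<open>y\<close> remains.\<close>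
    also have "m * (b - y - 1) + m * y = m * (b - 1)"
      using y by (simp flip: add_mult_distrib2)
    finally show ?thesis .
  qed
  have geometric: "(\<Sum>y\<in>{1..<b}. (q - 1) * q ^ (y - 1)) = q ^ (b - 1) - 1"
  proof -
    have "(\<Sum>y\<in>{1..<b}. (q - 1) * q ^ (y - 1)) = (\<Sum>y<b - 1. (q - 1) * q ^ y)"
      by (rule sum.reindex_bij_witness[where i = Suc and j = "\<lambda>y. y - 1"]) auto
    then show ?thesis
      by (simp add: power_diff_1_eq sum_distrib_left)
  qed
  have "(\<Sum>x\<in>weak_comps (Suc m) b. G (Suc m) x) =
      (\<Sum>(y, x)\<in>(SIGMA y:{..b}. weak_comps m (b - y)). G (Suc m) (x(m := y)))"
    using sum.reindex_bij_betw[OF bij_betw_weak_comps_Suc, of "G (Suc m)" m b]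
    by (simp add: case_prod_unfold)
  also have "\<dots> = (\<Sum>y\<le>b. T y)"
    unfolding T_def by (rule sum.Sigma[symmetric]) (auto simp: finite_weak_comps)
  also have "{..b} = insert 0 (insert b {1..<b})"
    using Suc.prems by auto
  also have "(\<Sum>y\<in>\<dots>. T y) = T 0 + (T b + (\<Sum>y\<in>{1..<b}. T y))"
    using Suc.prems by simp
  also have "(\<Sum>y\<in>{1..<b}. T y) = q ^ (m * (b - 1)) * q_int q m * (q ^ (b - 1) - 1)"
    unfolding geometric[symmetric] sum_distrib_left using T_mid by (intro sum.cong refl)
  \<comment> \<open>The \<open>- 1\<close> of the geometric sum cancels \<open>T 0\<close>.\<close>
  also have "T 0 + (T b + \<dots>) = q ^ (b - 1) * (q ^ (m * b) + q ^ (m * (b - 1)) * q_int q m)"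
    by (simp add: T_0 T_b algebra_simps)
  also have "m * b = m * (b - 1) + m"
    using Suc.prems by (cases b) auto
  also have "q ^ (b - 1) * (q ^ (m * (b - 1) + m) + q ^ (m * (b - 1)) * q_int q m) =
      q ^ (Suc m * (b - 1)) * q_int q (Suc m)"
    by (cases b) (use Suc.prems in \<open>simp_all add: q_int_def power_add algebra_simps\<close>)
  finally show ?case by (simp add: G_def)
qed

section \<open>Natural-number flows\<close>

text \<open>The arcs are \<open>(i, j)\<close> with \<open>j < d i\<close>, and a flow vanishes off the arcs, so that the inflow
  of \<open>k\<close> can be summed over all \<open>i\<close>.\<close>

definition flows :: "(nat \<Rightarrow> nat) \<Rightarrow> nat \<Rightarrow> (nat \<Rightarrow> nat) \<Rightarrow> (nat \<Rightarrow> nat \<Rightarrow> nat) set" where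
  "flows d n a = {f. (\<forall>i j. f i j \<noteq> 0 \<longrightarrow> i \<in> {1..n} \<and> j < d i) \<and>
    (\<forall>k\<in>{1..n}. (\<Sum>j<d k. f k j) = a k + (\<Sum>i=1..n. f i k))}"

text \<open>As \<open>d i \<le> i\<close>, arcs lead to smaller vertices. The last row is therefore
  a free choice among the weak compositions of \<open>a (Suc n)\<close>, and the other vertices see
  it only as additional netflow.\<close>

lemma bij_betw_flows_Suc:
  assumes d: "\<And>i. d i \<le> i"
  shows "bij_betw (\<lambda>(x, f). f(Suc n := x))
    (SIGMA x:weak_comps (d (Suc n)) (a (Suc n)). flows d n (\<lambda>k. a k + x k)) (flows d (Suc n) a)"
proof (rule bij_betw_byWitness[where f' = "\<lambda>f. (f (Suc n), f(Suc n := \<lambda>_. 0))"])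
  have restrict: "(\<Sum>i=1..n. (f(Suc n := x)) i k) = (\<Sum>i=1..n. f i k)"
    for f :: "nat \<Rightarrow> nat \<Rightarrow> nat" and x k
    by (rule sum.cong) auto
  show "\<forall>p\<in>SIGMA x:weak_comps (d (Suc n)) (a (Suc n)). flows d n (\<lambda>k. a k + x k).
      (\<lambda>f. (f (Suc n), f(Suc n := \<lambda>_. 0))) ((\<lambda>(x, f). f(Suc n := x)) p) = p"
    by (fastforce simp: flows_def fun_eq_iff)
  show "\<forall>f\<in>flows d (Suc n) a. (\<lambda>(x, f). f(Suc n := x)) (f (Suc n), f(Suc n := \<lambda>_. 0)) = f"
    by auto
  show "(\<lambda>(x, f). f(Suc n := x)) `
      (SIGMA x:weak_comps (d (Suc n)) (a (Suc n)). flows d n (\<lambda>k. a k + x k))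
      \<subseteq> flows d (Suc n) a"
  proof clarify
    fix x f
    assume x: "x \<in> weak_comps (d (Suc n)) (a (Suc n))"
      and f: "f \<in> flows d n (\<lambda>k. a k + x k)"
    \<comment> \<open>With \<open>x0\<close> below: nothing flows into the last vertex, so its
      balance says that its row has sum \<open>a (Suc n)\<close>.\<close>
    have f0: "f i (Suc n) = 0" for i
      using f d[of i] by (force simp: flows_def)
    have x0: "x (Suc n) = 0"
      using x d[of "Suc n"] by (force simp: weak_comps_def)
    show "f(Suc n := x) \<in> flows d (Suc n) a"
      unfolding flows_def
    proof (intro CollectI conjI allI ballI impI)
      fix i j
      assume "(f(Suc n := x)) i j \<noteq> 0"
      then show "i \<in> {1..Suc n}" "j < d i"
        using x f by (auto simp: flows_def weak_comps_def le_Suc_eq split: if_splits)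
    next
      fix k
      assume "k \<in> {1..Suc n}"
      then consider "k \<in> {1..n}" | "k = Suc n" by force
      then show "(\<Sum>j<d k. (f(Suc n := x)) k j) = a k + (\<Sum>i=1..Suc n. (f(Suc n := x)) i k)"
      proof cases
        case 1
        then show ?thesis
          using f restrict[of f x k] by (auto simp: flows_def)
      next
        case 2
        then show ?thesis
          using x restrict[of f x k] by (simp add: weak_comps_def f0 x0)
      qed
    qed
  qed
  show "(\<lambda>f. (f (Suc n), f(Suc n := \<lambda>_. 0))) ` flows d (Suc n) a \<subseteq>
      (SIGMA x:weak_comps (d (Suc n)) (a (Suc n)). flows d n (\<lambda>k. a k + x k))"
  proof clarify
    fix f
    assume f: "f \<in> flows d (Suc n) a"
    have f0: "f i (Suc n) = 0" for i
      using f d[of i] by (force simp: flows_def)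
    show "f (Suc n) \<in> weak_comps (d (Suc n)) (a (Suc n)) \<and>
        f(Suc n := \<lambda>_. 0) \<in> flows d n (\<lambda>k. a k + f (Suc n) k)"
    proof
      show "f (Suc n) \<in> weak_comps (d (Suc n)) (a (Suc n))"
        using f f0 by (auto simp: flows_def weak_comps_def)
      show "f(Suc n := \<lambda>_. 0) \<in> flows d n (\<lambda>k. a k + f (Suc n) k)"
        using f restrict[of f "\<lambda>_. 0"] by (auto simp: flows_def le_Suc_eq)
    qed
  qed
qed

lemma finite_flows:
  assumes "\<And>i. d i \<le> i"
  shows "finite (flows d n a)"
proof (induction n arbitrary: a)
  case 0
  show ?case by (rule finite_subset[of _ "{\<lambda>_ _. 0}"]) (auto simp: flows_def fun_eq_iff)
next
  case (Suc n)
  show ?case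
    using bij_betw_finite[OF bij_betw_flows_Suc[OF assms, of n a]] Suc finite_weak_comps by auto
qed

text \<open>Additional netflow \<open>x i\<close> at \<open>i\<close> contributes a factor
  \<open>q ^ (d i * x i)\<close>. By \<open>full\<close> this is \<open>q ^ (i * x i)\<close>
  wherever \<open>x i\<close> is positive, which is the weight that \<open>sum_row_wt\<close> can
  sum.\<close>

lemma sum_flows:
  fixes q :: "'a::field"
  assumes d: "\<And>i. d i \<le> i"
    and full: "\<And>i k. i < k \<Longrightarrow> k \<le> n \<Longrightarrow> i < d k \<Longrightarrow> d i = i"
    and "\<And>i. i \<in> {1..n} \<Longrightarrow> a i > 0"
  shows "(\<Sum>f\<in>flows d n a. \<Prod>k=1..n. row_wt q (d k) (f k)) =
    (\<Prod>k=1..n. q ^ (d k * (a k - 1)) * q_int q (d k))"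
  using assms(2,3)
proof (induction n arbitrary: a)
  case 0
  have "flows d 0 a = {\<lambda>_ _. 0}"
    by (auto simp: flows_def fun_eq_iff)
  then show ?case by simp
next
  case (Suc n)
  define m where "m = d (Suc n)"
  define C where "C = weak_comps m (a (Suc n))"
  define P where "P = (\<Prod>k=1..n. q ^ (d k * (a k - 1)) * q_int q (d k))"
  have inner: "(\<Sum>f\<in>flows d n (\<lambda>k. a k + x k). \<Prod>k=1..n. row_wt q (d k) (f k)) =
      P * q ^ (\<Sum>j<m. j * x j)" if x: "x \<in> C" for x
  proof -
    have x0: "j < m" if "x j \<noteq> 0" for j
      using x that by (auto simp: C_def weak_comps_def)
    have dx: "d k * x k = k * x k" if "k \<in> {1..n}" for k
      using x0[of k] that Suc.prems(1)[of k "Suc n"] by (cases "x k = 0") (auto simp: m_def)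
    have "(\<Sum>f\<in>flows d n (\<lambda>k. a k + x k). \<Prod>k=1..n. row_wt q (d k) (f k)) =
        (\<Prod>k=1..n. q ^ (d k * (a k + x k - 1)) * q_int q (d k))"
      by (rule Suc.IH) (use Suc.prems in auto)
    also have "\<dots> = (\<Prod>k=1..n. q ^ (d k * (a k - 1)) * q_int q (d k) * q ^ (k * x k))"
    proof (rule prod.cong)
      fix k assume k: "k \<in> {1..n}"
      have "d k * (a k + x k - 1) = d k * (a k - 1) + k * x k"
        using Suc.prems(2)[of k] k dx[OF k] by (cases "a k") (auto simp: algebra_simps)
      then show "q ^ (d k * (a k + x k - 1)) * q_int q (d k) =
          q ^ (d k * (a k - 1)) * q_int q (d k) * q ^ (k * x k)"
        by (simp add: power_add)
    qed simp
    also have "\<dots> = P * q ^ (\<Sum>k=1..n. k * x k)"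
      by (simp add: P_def prod.distrib power_sum)
    \<comment> \<open>The index 0 contributes nothing, \<open>x\<close> vanishes from
      \<open>m\<close> on, and \<open>m \<le> Suc n\<close>.\<close>
    also have "(\<Sum>k=1..n. k * x k) = (\<Sum>j<m. j * x j)"
    proof (rule sum.mono_neutral_cong)
      fix j assume "j \<in> {..<m} - {1..n}"
      then show "j * x j = 0" using d[of "Suc n"] by (cases "j = 0") (auto simp: m_def)
    qed (use x0 in auto)
    finally show ?thesis .
  qed
  have upd: "(\<Prod>k=1..Suc n. row_wt q (d k) ((f(Suc n := x)) k)) =
      row_wt q m x * (\<Prod>k=1..n. row_wt q (d k) (f k))" for x and f :: "nat \<Rightarrow> nat \<Rightarrow> nat"
  proof -
    have "(\<Prod>k=1..n. row_wt q (d k) ((f(Suc n := x)) k)) = (\<Prod>k=1..n. row_wt q (d k) (f k))"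
      by (rule prod.cong) auto
    then show ?thesis by (simp add: m_def)
  qed
  have "(\<Sum>f\<in>flows d (Suc n) a. \<Prod>k=1..Suc n. row_wt q (d k) (f k)) =
      (\<Sum>(x, f)\<in>(SIGMA x:C. flows d n (\<lambda>k. a k + x k)).
        \<Prod>k=1..Suc n. row_wt q (d k) ((f(Suc n := x)) k))"
    using sum.reindex_bij_betw[OF bij_betw_flows_Suc[OF d],
        of "\<lambda>f. \<Prod>k=1..Suc n. row_wt q (d k) (f k)" n a]
    unfolding C_def m_def case_prod_unfold by (rule sym)
  also have "\<dots> = (\<Sum>x\<in>C. \<Sum>f\<in>flows d n (\<lambda>k. a k + x k).
      row_wt q m x * (\<Prod>k=1..n. row_wt q (d k) (f k)))"
    unfolding upd
    by (rule sum.Sigma[symmetric]) (auto simp: C_def finite_weak_comps finite_flows[OF d])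
  also have "\<dots> = (\<Sum>x\<in>C. row_wt q m x * (P * q ^ (\<Sum>j<m. j * x j)))"
    by (intro sum.cong refl) (simp only: inner flip: sum_distrib_left)
  also have "\<dots> = P * (\<Sum>x\<in>C. row_wt q m x * q ^ (\<Sum>j<m. j * x j))"
    by (simp add: sum_distrib_left mult_ac)
  also have "\<dots> = P * (q ^ (m * (a (Suc n) - 1)) * q_int q m)"
    unfolding C_def using sum_row_wt[of "a (Suc n)" q m] Suc.prems(2)[of "Suc n"] by simp
  finally show ?case by (simp add: P_def m_def)
qed

section \<open>Threshold graphs\<close>

lemma threshold_graph_finite: "threshold_graph V E \<Longrightarrow> finite V"
  by (induction rule: threshold_graph.induct) auto

lemma threshold_graph_edge:
  assumes "threshold_graph V E" "e \<in> E"
  obtains u v where "e = {u, v}" "u \<noteq> v" "u \<in> V" "v \<in> V"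
  using assms
proof (induction arbitrary: thesis rule: threshold_graph.induct)
  case (dominating V E v)
  then show ?case by auto
qed auto

lemma threshold_graph_adj:
  assumes "threshold_graph V E" "{u, v} \<in> E"
  shows "u \<in> V" "v \<in> V" "u \<noteq> v"
  using threshold_graph_edge[OF assms] by (auto simp: doubleton_eq_iff)

text \<open>The vicinal preorder of a threshold graph is total: a new vertex enters no old
  neighbourhood or that of every vertex present, and is itself at one end of the order.\<close>

lemma threshold_graph_nested:
  assumes "threshold_graph V E"
  shows "(\<forall>w. w \<noteq> v \<longrightarrow> {u, w} \<in> E \<longrightarrow> {v, w} \<in> E) \<or> (\<forall>w. w \<noteq> u \<longrightarrow> {v, w} \<in> E \<longrightarrow> {u, w} \<in> E)"
  using assms
proof (induction rule: threshold_graph.induct)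
  case (dominating V E z)
  have adj: "{x, y} \<in> E \<union> {{u, z} |u. u \<in> V} \<longleftrightarrow> {x, y} \<in> E \<or> (x = z \<and> y \<in> V) \<or> (y = z \<and> x \<in> V)" for x y
    by (auto simp: doubleton_eq_iff)
  show ?case
    unfolding adj
    using dominating.IH threshold_graph_adj[OF dominating.hyps(1)] dominating.hyps(2) by metis
qed auto

lemma degree_eq_card_neighbours:
  assumes "threshold_graph V E"
  shows "degree E v = card {w. {v, w} \<in> E}"
proof -
  have "{e \<in> E. v \<in> e} = (\<lambda>w. {v, w}) ` {w. {v, w} \<in> E}"
  proof (intro equalityI subsetI)
    fix e assume e: "e \<in> {e \<in> E. v \<in> e}"
    then obtain w where "e = {v, w}"
      using threshold_graph_edge[OF assms, of e] by (metis (no_types, lifting) insertE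
          insert_commute mem_Collect_eq singletonD)
    then show "e \<in> (\<lambda>w. {v, w}) ` {w. {v, w} \<in> E}"
      using e by blast
  qed auto
  moreover have "inj_on (\<lambda>w. {v, w}) {w. {v, w} \<in> E}"
    by (auto simp: inj_on_def doubleton_eq_iff)
  ultimately show ?thesis
    by (simp add: degree_def card_image)
qed

text \<open>Neighbourhoods are nested, so a neighbour \<open>w\<close> of \<open>v\<close> that
  \<open>u\<close> lacks would make the neighbourhood of \<open>u\<close> the strictly smaller
  one.\<close>

lemma threshold_graph_degree_mono:
  assumes tg: "threshold_graph V E" and deg: "degree E v \<le> degree E u"
    and "{v, w} \<in> E" "w \<noteq> u"
  shows "{u, w} \<in> E"
proof (rule ccontr)
  assume no: "{u, w} \<notin> E"
  define N where "N x = {w. {x, w} \<in> E}" for x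
  have fin: "finite (N x)" for x
    using threshold_graph_adj[OF tg] threshold_graph_finite[OF tg]
    by (intro finite_subset[of "N x" V]) (auto simp: N_def)
  have "{v, x} \<in> E" if "{u, x} \<in> E" "x \<noteq> v" for x
    using threshold_graph_nested[OF tg, of v u] that assms(3,4) no by blast
  moreover have "w \<noteq> v"
    using threshold_graph_adj(3)[OF tg assms(3)] by simp
  ultimately have "N u - {v} \<subset> N v - {u}"
    using assms(3,4) no threshold_graph_adj(3)[OF tg] unfolding N_def by blast
  then have "card (N u - {v}) < card (N v - {u})"
    by (intro psubset_card_mono) (auto simp: fin)
  \<comment> \<open>Removing \<open>v\<close> and \<open>u\<close> respectively thus lowers both
    cardinalities by the same amount.\<close>
  moreover have "v \<in> N u \<longleftrightarrow> u \<in> N v"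
    by (simp add: N_def insert_commute)
  ultimately have "card (N u) < card (N v)"
    using fin by (cases "v \<in> N u") (auto simp: card_Diff_singleton_if card_gt_0_iff)
  then show False
    using deg by (simp add: degree_eq_card_neighbours[OF tg] N_def)
qed

lemma down_closed_eq_lessThan_card:
  fixes S :: "nat set"
  assumes "finite S" "\<And>i j. j \<in> S \<Longrightarrow> i < j \<Longrightarrow> i \<in> S"
  shows "S = {..<card S}"
proof -
  obtain k where k: "k \<notin> S" "\<And>i. i < k \<Longrightarrow> i \<in> S"
    using assms(1) exists_least_iff[of "\<lambda>k. k \<notin> S"] ex_new_if_finite[OF infinite_UNIV_nat] by metis
  have "S = {..<k}"
    using k assms(2) by (metis lessThan_iff linorder_neqE_nat subsetI subset_antisym)
  then show ?thesis by simp
qed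

section \<open>Neighbourhoods under the reverse degree labeling\<close>

context
  fixes n :: nat and E :: "nat set set"
  assumes tg: "threshold_graph {0..n} E" and lab: "reverse_degree_labeled n E"
begin

text \<open>A smaller label has at least the same degree, hence inherits the neighbours of a larger
  one.\<close>

lemma adj_down_closed:
  assumes "{i, j} \<in> E" "k < j" "k \<noteq> i"
  shows "{i, k} \<in> E"
proof -
  have "degree E j \<le> degree E k"
    using lab threshold_graph_adj[OF tg assms(1)] assms(2)
    unfolding reverse_degree_labeled_def by auto
  then show ?thesis
    using threshold_graph_degree_mono[OF tg, of j k i] assms by (simp add: insert_commute)
qed

lemma adj_iff_less_dbar:
  assumes "j < i"
  shows "{i, j} \<in> E \<longleftrightarrow> j < dbar E i"
proof -
  have "{j. j < i \<and> {i, j} \<in> E} = {..<dbar E i}"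
    unfolding dbar_def by (rule down_closed_eq_lessThan_card) (use adj_down_closed in auto)
  then show ?thesis using assms by blast
qed

lemma dbar_le: "dbar E i \<le> i"
  unfolding dbar_def using card_mono[of "{..<i}" "{j. j < i \<and> {i, j} \<in> E}"] by auto

text \<open>A neighbour \<open>k\<close> above \<open>i\<close> forces every vertex below
  \<open>i\<close> to be a neighbour of \<open>i\<close>. This provides the assumption
  \<open>full\<close> of \<open>sum_flows\<close>.\<close>

lemma dbar_eq_self:
  assumes "{i, k} \<in> E" "i < k"
  shows "dbar E i = i"
proof -
  have "{j. j < i \<and> {i, j} \<in> E} = {..<i}"
    using adj_down_closed[OF assms(1)] assms(2) by auto
  then show ?thesis by (simp add: dbar_def)
qed

text \<open>If \<open>i\<close> has a larger neighbour, \<open>dbar_eq_self\<close> applies;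
  otherwise all its neighbours are smaller and \<open>dbar\<close> counts the whole degree.\<close>

lemma dbar_eq_min: "dbar E i = min (degree E i) i"
proof -
  have fin: "finite {w. {i, w} \<in> E}"
    by (rule finite_subset[of _ "{0..n}"]) (use threshold_graph_adj(2)[OF tg, of i] in blast)+
  have "dbar E i \<le> degree E i"
    unfolding dbar_def degree_eq_card_neighbours[OF tg] by (rule card_mono[OF fin]) auto
  moreover have "dbar E i = degree E i" if "\<nexists>k. i < k \<and> {i, k} \<in> E"
  proof -
    have "{w. {i, w} \<in> E} = {j. j < i \<and> {i, j} \<in> E}"
      using that threshold_graph_adj(3)[OF tg] by (metis linorder_neqE_nat)
    then show ?thesis by (simp add: dbar_def degree_eq_card_neighbours[OF tg])
  qed
  ultimately show ?thesis
    using dbar_eq_self dbar_le[of i] by fastforce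
qed

section \<open>Lattice points of the flow polytope and their weights\<close>

lemma arcs_eq: "arcs E = (SIGMA i:{1..n}. {..<dbar E i})"
proof -
  have "(i, j) \<in> arcs E \<longleftrightarrow> (i, j) \<in> (SIGMA i:{1..n}. {..<dbar E i})" for i j
    using threshold_graph_adj[OF tg, of i j] adj_iff_less_dbar[of j i] dbar_le[of i]
    by (auto simp: arcs_def)
  then show ?thesis by auto
qed

lemma net_flow_eq:
  "net_flow E x k = (\<Sum>j<dbar E k. if k \<in> {1..n} then x (k, j) else 0) -
    (\<Sum>i=1..n. if k < dbar E i then x (i, k) else 0)"
proof -
  have "(\<Sum>e\<in>{e \<in> arcs E. fst e = k}. x e) =
      (\<Sum>j<dbar E k. if k \<in> {1..n} then x (k, j) else 0)"
  proof (cases "k \<in> {1..n}")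
    case True
    have "(\<Sum>e\<in>{e \<in> arcs E. fst e = k}. x e) = (\<Sum>j<dbar E k. x (k, j))"
      by (rule sum.reindex_bij_witness[where i = "Pair k" and j = snd])
        (use True in \<open>auto simp: arcs_eq\<close>)
    then show ?thesis using True by simp
  next
    case False
    then have "{e \<in> arcs E. fst e = k} = {}" by (auto simp: arcs_eq)
    then show ?thesis using False by (simp only: if_False sum.empty sum.neutral_const)
  qed
  moreover have "(\<Sum>e\<in>{e \<in> arcs E. snd e = k}. x e) =
      (\<Sum>i=1..n. if k < dbar E i then x (i, k) else 0)"
  proof -
    have "(\<Sum>e\<in>{e \<in> arcs E. snd e = k}. x e) = (\<Sum>i\<in>{i \<in> {1..n}. k < dbar E i}. x (i, k))"
      by (rule sum.reindex_bij_witness[where i = "\<lambda>i. (i, k)" and j = fst])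
        (auto simp: arcs_eq)
    then show ?thesis by (subst sum.inter_filter[symmetric]) auto
  qed
  ultimately show ?thesis by (simp add: net_flow_def)
qed

text \<open>Every arc counts positively at its tail and negatively at its head. This yields the
  netflow at 0 of a point built from a natural-number flow.\<close>

lemma sum_net_flow: "(\<Sum>k=0..n. net_flow E x k) = 0"
proof -
  have fin: "finite (arcs E)" by (simp add: arcs_eq)
  have "fst ` arcs E \<subseteq> {0..n}" by (auto simp: arcs_eq)
  moreover have "snd ` arcs E \<subseteq> {0..n}"
  proof clarify
    fix i j assume "(i, j) \<in> arcs E"
    then show "snd (i, j) \<in> {0..n}" using dbar_le[of i] by (auto simp: arcs_eq)
  qed
  ultimately show ?thesis
    by (simp add: net_flow_def sum_subtractf sum.group[OF fin])
qed

definition of_flow :: "(nat \<Rightarrow> nat \<Rightarrow> nat) \<Rightarrow> nat \<times> nat \<Rightarrow> real" where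
  "of_flow f = (\<lambda>e\<in>arcs E. real (f (fst e) (snd e)))"

lemma net_flow_of_flow:
  assumes f: "\<And>i j. f i j \<noteq> 0 \<Longrightarrow> i \<in> {1..n} \<and> j < dbar E i"
  shows "net_flow E (of_flow f) k = real (\<Sum>j<dbar E k. f k j) - real (\<Sum>i=1..n. f i k)"
proof -
  have "(\<Sum>j<dbar E k. if k \<in> {1..n} then of_flow f (k, j) else 0) = (\<Sum>j<dbar E k. real (f k j))"
    by (rule sum.cong) (use f in \<open>auto simp: of_flow_def arcs_eq\<close>)
  moreover have "(\<Sum>i=1..n. if k < dbar E i then of_flow f (i, k) else 0) =
      (\<Sum>i=1..n. real (f i k))"
    by (rule sum.cong) (use f in \<open>auto simp: of_flow_def arcs_eq\<close>)
  ultimately show ?thesis by (simp add: net_flow_eq)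
qed

text \<open>Coordinates of a lattice point are nonnegative integers, so \<open>nat\<close> and floor
  recover them exactly; since \<open>a\<close> is positive, \<open>nat (a k)\<close> loses nothing
  either.\<close>

lemma bij_betw_of_flow:
  assumes a: "\<And>i. i \<in> {1..n} \<Longrightarrow> a i > 0"
  shows "bij_betw of_flow (flows (dbar E) n (\<lambda>k. nat (a k)))
    (flow_polytope n E a \<inter> {x. \<forall>e\<in>arcs E. x e \<in> \<int>})"
proof -
  \<comment> \<open>Off the arcs the value is 0, as \<open>flows\<close> demands, whereas points of
    the polytope are \<open>undefined\<close> there.\<close>
  define to_flow where
    "to_flow x = (\<lambda>i j. if (i, j) \<in> arcs E then nat \<lfloor>x (i, j) :: real\<rfloor> else 0)" for x
  have conserve: "net_flow E (of_flow f) k = of_int (a k) \<longleftrightarrow>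
      (\<Sum>j<dbar E k. f k j) = nat (a k) + (\<Sum>i=1..n. f i k)"
    if "k \<in> {1..n}" "\<And>i j. f i j \<noteq> 0 \<Longrightarrow> i \<in> {1..n} \<and> j < dbar E i" for f k
  proof -
    have "of_int (a k) = real (nat (a k))" using a[OF that(1)] by simp
    then have "net_flow E (of_flow f) k = of_int (a k) \<longleftrightarrow>
        real (\<Sum>j<dbar E k. f k j) = real (nat (a k) + (\<Sum>i=1..n. f i k))"
      using net_flow_of_flow[of f k] that(2) unfolding of_nat_add by (smt (verit))
    then show ?thesis by (simp only: of_nat_eq_iff)
  qed
  show ?thesis
  proof (rule bij_betw_byWitness[where f' = to_flow])
    show "\<forall>f\<in>flows (dbar E) n (\<lambda>k. nat (a k)). to_flow (of_flow f) = f"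
      by (auto simp: flows_def to_flow_def of_flow_def arcs_eq fun_eq_iff)
    show of_to: "\<forall>x\<in>flow_polytope n E a \<inter> {x. \<forall>e\<in>arcs E. x e \<in> \<int>}. of_flow (to_flow x) = x"
    proof
      fix x
      assume x: "x \<in> flow_polytope n E a \<inter> {x. \<forall>e\<in>arcs E. x e \<in> \<int>}"
      show "of_flow (to_flow x) = x"
      proof
        fix e
        show "of_flow (to_flow x) e = x e"
        proof (cases "e \<in> arcs E")
          case True
          then have "x e \<ge> 0" "x e \<in> \<int>"
            using x by (auto simp: flow_polytope_def PiE_iff)
          then show ?thesis
            using True by (auto simp: of_flow_def to_flow_def elim!: Ints_cases)
        next
          case False
          then show ?thesis
            using x PiE_arb[of x "arcs E" "\<lambda>_. {0..}" e] by (simp add: of_flow_def flow_polytope_def)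
        qed
      qed
    qed
    show "of_flow ` flows (dbar E) n (\<lambda>k. nat (a k)) \<subseteq>
        flow_polytope n E a \<inter> {x. \<forall>e\<in>arcs E. x e \<in> \<int>}"
    proof
      fix x assume "x \<in> of_flow ` flows (dbar E) n (\<lambda>k. nat (a k))"
      then obtain f where f: "f \<in> flows (dbar E) n (\<lambda>k. nat (a k))" and x: "x = of_flow f"
        by blast
      have net: "net_flow E x k = of_int (a k)" if "k \<in> {1..n}" for k
        unfolding x using conserve[OF that, of f] f that by (auto simp: flows_def)
      have "{0..n} = insert 0 {1..n}" by auto
      then have "net_flow E x 0 + (\<Sum>k=1..n. net_flow E x k) = 0"
        using sum_net_flow[of x] by simp
      then have "net_flow E x 0 = - of_int (\<Sum>i=1..n. a i)"
        using net by simp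
      moreover have "x \<in> arcs E \<rightarrow>\<^sub>E {0..}" "\<forall>e\<in>arcs E. x e \<in> \<int>"
        by (auto simp: x of_flow_def)
      ultimately show "x \<in> flow_polytope n E a \<inter> {x. \<forall>e\<in>arcs E. x e \<in> \<int>}"
        using net by (auto simp: flow_polytope_def)
    qed
    show "to_flow ` (flow_polytope n E a \<inter> {x. \<forall>e\<in>arcs E. x e \<in> \<int>}) \<subseteq>
        flows (dbar E) n (\<lambda>k. nat (a k))"
    proof
      fix f assume "f \<in> to_flow ` (flow_polytope n E a \<inter> {x. \<forall>e\<in>arcs E. x e \<in> \<int>})"
      \<comment> \<open>Seeing the point as \<open>of_flow f\<close> lets \<open>conserve\<close>
        serve this direction as well.\<close>
      then obtain x where x: "x \<in> flow_polytope n E a" "of_flow f = x" and f: "f = to_flow x"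
        using of_to by auto
      have supp: "i \<in> {1..n} \<and> j < dbar E i" if "f i j \<noteq> 0" for i j
        using that by (auto simp: f to_flow_def arcs_eq split: if_splits)
      have "(\<Sum>j<dbar E k. f k j) = nat (a k) + (\<Sum>i=1..n. f i k)" if "k \<in> {1..n}" for k
        using conserve[OF that, of f] supp x that by (auto simp: flow_polytope_def)
      then show "f \<in> flows (dbar E) n (\<lambda>k. nat (a k))"
        using supp by (simp add: flows_def)
    qed
  qed
qed

text \<open>At \<open>t = 0\<close> the base of the power is \<open>q - 1\<close>, and
  \<open>q \<noteq> 0\<close> turns \<open>q ^ b / q\<close> into \<open>q ^ (b - 1)\<close>. Every
  vertex has positive outflow, so the \<open>- n\<close> in the exponent can be shared out as one
  \<open>- 1\<close> per row.\<close>

lemma wt_flow_of_flow: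
  fixes q :: "'a::field"
  assumes q: "q \<noteq> 0" and f: "f \<in> flows (dbar E) n b"
    and b: "\<And>i. i \<in> {1..n} \<Longrightarrow> b i > 0"
  shows "wt_flow q 0 n E (of_flow f) = (\<Prod>k=1..n. row_wt q (dbar E k) (f k))"
proof -
  define c where "c k = card {j. j < dbar E k \<and> 0 < f k j}" for k
  have "{e \<in> arcs E. of_flow f e > 0} = (SIGMA k:{1..n}. {j. j < dbar E k \<and> 0 < f k j})"
    by (auto simp: of_flow_def arcs_eq)
  then have card: "card {e \<in> arcs E. of_flow f e > 0} = (\<Sum>k=1..n. c k)"
    by (simp add: c_def)
  have c_pos: "c k > 0" if "k \<in> {1..n}" for k
  proof -
    have "f k \<in> weak_comps (dbar E k) (b k + (\<Sum>i=1..n. f i k))"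
      using f that by (auto simp: flows_def weak_comps_def)
    then show ?thesis
      unfolding c_def by (rule card_support_pos) (use b[OF that] in simp)
  qed
  have "(\<Sum>k=1..n. c k) = (\<Sum>k=1..n. (c k - 1) + 1)"
    using c_pos by (intro sum.cong) (auto simp: Suc_le_eq)
  also have "\<dots> = (\<Sum>k=1..n. c k - 1) + n"
    by (simp only: sum.distrib) simp
  \<comment> \<open>The exponent is a natural number, so \<open>powi\<close> is an ordinary power
    even at \<open>q = 1\<close>, where the base is 0.\<close>
  finally have "int (card {e \<in> arcs E. of_flow f e > 0}) - int n = int (\<Sum>k=1..n. c k - 1)"
    using card by simp
  then have power: "(- ((1 - 0) * (1 - q))) powi (int (card {e \<in> arcs E. of_flow f e > 0}) - int n) =
      (\<Prod>k=1..n. (q - 1) ^ (c k - 1))"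
    by (simp only: power_int_of_nat) (simp add: power_sum)
  have "(\<Prod>e\<in>arcs E. wt q 0 (nat \<lfloor>of_flow f e\<rfloor>)) =
      (\<Prod>(k, j)\<in>arcs E. if f k j = 0 then 1 else q ^ (f k j - 1))"
    using q by (intro prod.cong) (auto simp: wt_def of_flow_def power_diff)
  also have "\<dots> = (\<Prod>k=1..n. \<Prod>j<dbar E k. if f k j = 0 then 1 else q ^ (f k j - 1))"
    unfolding arcs_eq by (rule prod.Sigma[symmetric]) auto
  finally show ?thesis
    unfolding wt_flow_def power by (simp add: row_wt_def c_def prod.distrib)
qed

end

theorem theorem4p2:
  fixes n :: nat and E :: "nat set set" and a :: "nat \<Rightarrow> int" and q :: "'a::field"
  assumes "threshold_graph {0..n} E"
    and "reverse_degree_labeled n E"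
    and "\<And>i. i \<in> {1..n} \<Longrightarrow> a i > 0"
    and "q \<noteq> 0"
  shows "(\<forall>i\<in>{1..n}. dbar E i = min (degree E i) i) \<and>
    Ehr q 0 n E a = (\<Prod>i=1..n. q powi (int (dbar E i) * (a i - 1)) * q_int q (dbar E i))"
proof
  note tg = assms(1,2)
  show "\<forall>i\<in>{1..n}. dbar E i = min (degree E i) i"
    using dbar_eq_min[OF tg] by blast
  let ?b = "\<lambda>k. nat (a k)"
  have "Ehr q 0 n E a = (\<Sum>f\<in>flows (dbar E) n ?b. wt_flow q 0 n E (of_flow E f))"
    unfolding Ehr_def by (rule sum.reindex_bij_betw[OF bij_betw_of_flow[OF tg assms(3)], symmetric])
  also have "\<dots> = (\<Sum>f\<in>flows (dbar E) n ?b. \<Prod>k=1..n. row_wt q (dbar E k) (f k))"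
    using assms(3) by (intro sum.cong refl wt_flow_of_flow[OF tg assms(4)]) auto
  also have "\<dots> = (\<Prod>k=1..n. q ^ (dbar E k * (?b k - 1)) * q_int q (dbar E k))"
  proof (rule sum_flows)
    show "dbar E i = i" if "i < k" "i < dbar E k" for i k
      using dbar_eq_self[OF tg, of i k] adj_iff_less_dbar[OF tg, of i k] that
      by (simp add: insert_commute)
  qed (use assms(3) dbar_le[OF tg] in auto)
  also have "\<dots> = (\<Prod>i=1..n. q powi (int (dbar E i) * (a i - 1)) * q_int q (dbar E i))"
  proof (rule prod.cong)
    fix k assume "k \<in> {1..n}"
    \<comment> \<open>As \<open>a k \<ge> 1\<close>, the truncated subtraction is exact.\<close>
    then have "int (dbar E k) * (a k - 1) = int (dbar E k * (?b k - 1))"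
      using assms(3)[of k] by simp
    then show "q ^ (dbar E k * (?b k - 1)) * q_int q (dbar E k) =
        q powi (int (dbar E k) * (a k - 1)) * q_int q (dbar E k)"
      by (simp only: power_int_of_nat)
  qed simp
  finally show "Ehr q 0 n E a =
      (\<Prod>i=1..n. q powi (int (dbar E i) * (a i - 1)) * q_int q (dbar E i))" .
qed

end
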